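(* Let $n$ be a positive integer and let $B$ be a set of points of $PG(n,2)$. Then $B$ is a minimal blocking set in $PG(n,2)$ if and only if the subspace $\langle B\rangle$ of $PG(n,2)$ spanned by $B$ is a projective space $PG(d,2)$ of (projective) dimension $d$ with $d$ odd, and $B$ consists of exactly $d+2$ points of this $PG(d,2)$, no $d+1$ of which lie in the same hyperplane of $PG(d,2)$.
   Context: $PG(n,q)$ is the $n$-dimensional projective space over the finite field $\mathbb{F}_q$: its points are the one-dimensional subspaces of $(\mathbb{F}_q)^{n+1}$, and its hyperplanes correspond to the $n$-dimensional linear subspaces of $(\mathbb{F}_q)^{n+1}$. A blocking set in $PG(n,q)$ is a set of points having nonempty intersection with every hyperplane of $PG(n,q)$. A blocking set is minimal if none of its proper subsets is a blocking set. *)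

theory Defs
  imports "HOL-Analysis.Cartesian_Space" "HOL-Library.Z2"
begin

text \<open>
  A projective subspace of \<open>PG(n,q)\<close> is represented by the underlying linear subspace of
  \<open>'a ^ 'n\<close>, where \<open>'a\<close> is the field with \<open>q\<close> elements and \<open>CARD('n) = n + 1\<close>;
  \<open>PG(n,q)\<close> itself is \<open>UNIV\<close>. Points and hyperplanes are taken relative to such a
  subspace \<open>W\<close>, so that they also make sense inside a subspace \<open>PG(d,q)\<close> of \<open>PG(n,q)\<close>.
  The projective dimension is an integer, so that it is \<open>-1\<close> for the empty projective space.
\<close>

definition pg_dim :: "('a::field ^ 'n) set \<Rightarrow> int" where
  "pg_dim W = int (vec.dim W) - 1"

definition pg_points :: "('a::field ^ 'n) set \<Rightarrow> ('a ^ 'n) set set" where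
  "pg_points W = {P. vec.subspace P \<and> P \<subseteq> W \<and> vec.dim P = 1}"

definition pg_hyperplanes :: "('a::field ^ 'n) set \<Rightarrow> ('a ^ 'n) set set" where
  "pg_hyperplanes W = {H. vec.subspace H \<and> H \<subseteq> W \<and> pg_dim H = pg_dim W - 1}"

definition pg_span :: "('a::field ^ 'n) set set \<Rightarrow> ('a ^ 'n) set" where
  "pg_span B = vec.span (\<Union>B)"

definition blocking_set :: "('a::field ^ 'n) set set \<Rightarrow> bool" where
  "blocking_set B \<longleftrightarrow>
     B \<subseteq> pg_points UNIV \<and> (\<forall>H \<in> pg_hyperplanes UNIV. B \<inter> pg_points H \<noteq> {})"

definition minimal_blocking_set :: "('a::field ^ 'n) set set \<Rightarrow> bool" where
  "minimal_blocking_set B \<longleftrightarrow> blocking_set B \<and> (\<forall>B'. B' \<subset> B \<longrightarrow> \<not> blocking_set B')"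

end

theory Submission
  imports Defs
begin

text \<open>
  A point of \<open>PG(n,2)\<close> is a nonzero vector, and a sum of vectors outside a hyperplane lies in
  the hyperplane exactly when the number of summands is even. Hence a set of points is blocking
  iff some subset of odd size sums to zero: otherwise the sums of evenly many of its vectors form
  a subspace that misses the set, and this subspace extends to a hyperplane that still does. So a
  minimal blocking set is a set of odd size whose only nonempty subset with sum zero is the whole
  set, i.e. a circuit of odd size, and a circuit of \<open>d + 2\<close> vectors is the same thing as
  \<open>d + 2\<close> vectors of rank \<open>d + 1\<close> of which any \<open>d + 1\<close> are independent.
\<close>

section \<open>Hyperplanes\<close>

text \<open>Among the subspaces of \<open>W\<close> that contain \<open>E\<close> and miss
  \<open>v\<close>, one of largest dimension has codimension one: enlarging it by any further vector
  of \<open>W\<close> captures \<open>v\<close>.\<close>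

lemma exists_hyperplane_avoiding:
  fixes E W :: "('a::field ^ 'n::finite) set"
  assumes E: "vec.subspace E" "E \<subseteq> W" and W: "vec.subspace W" and v: "v \<in> W" "v \<notin> E"
  obtains H where "H \<in> pg_hyperplanes W" "E \<subseteq> H" "v \<notin> H"
proof -
  let ?P = "\<lambda>H. vec.subspace H \<and> H \<subseteq> W \<and> E \<subseteq> H \<and> v \<notin> H"
  have "\<exists>H. ?P H \<and> (\<forall>H'. ?P H' \<longrightarrow> vec.dim H' \<le> vec.dim H)"
  proof (rule ex_has_greatest_nat)
    show "?P E" using assms by blast
    \<comment> \<open>\<open>ex_has_greatest_nat\<close> asks for a strict upper bound, hence
      \<open>Suc\<close>.\<close>
    show "\<forall>H. ?P H \<longrightarrow> vec.dim H < Suc CARD('n)"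
      by (metis vec.dim_subset_UNIV vec.dimension_def card_cart_basis less_Suc_eq_le)
  qed
  then obtain H where H: "?P H" and max: "\<And>H'. ?P H' \<Longrightarrow> vec.dim H' \<le> vec.dim H"
    by blast
  have span_H: "vec.span H = H" using H by simp
  have "x \<in> vec.span (insert v H)" if x: "x \<in> W" for x
  proof (cases "x \<in> H")
    case True
    then show ?thesis by (simp add: vec.span_base)
  next
    case False
    then have "x \<notin> vec.span H" by (simp only: span_H not_False_eq_True)
    then have "vec.dim (vec.span (insert x H)) = vec.dim H + 1"
      by (simp add: vec.dim_insert)
    moreover have "vec.span (insert x H) \<subseteq> W"
      using H x W by (simp add: vec.span_minimal)
    moreover have "E \<subseteq> vec.span (insert x H)"
      using H by (meson subset_insertI subset_trans vec.span_superset)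
    ultimately have "v \<in> vec.span (insert x H)"
      using max[of "vec.span (insert x H)"] by force
    \<comment> \<open>Exchange: \<open>v\<close> lies in the span of \<open>insert x H\<close> but
      not in that of \<open>H\<close>, so \<open>x\<close> lies in the span of
      \<open>insert v H\<close>.\<close>
    then show ?thesis
      using H span_H vec.in_span_insert by metis
  qed
  then have "vec.span (insert v H) = W"
    using H W v vec.span_minimal[of "insert v H" W] by auto
  moreover have "v \<notin> vec.span H" using H by (simp only: span_H not_False_eq_True)
  ultimately have "vec.dim W = vec.dim H + 1"
    using vec.dim_insert[of v H] vec.dim_span[of "insert v H"] by simp
  then have "H \<in> pg_hyperplanes W"
    using H by (simp add: pg_hyperplanes_def pg_dim_def)
  then show ?thesis using that H by blast
qed

section \<open>Linear algebra over the field with two elements\<close>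

text \<open>The type \<open>bit ^ 'n\<close> thereby becomes finite, so sums and cardinalities of
  sets of vectors never fall back on the default value for infinite sets.\<close>

instance bit :: finite
proof
  have "(UNIV :: bit set) = {0, 1}"
    using bit_not_one_iff by blast
  then show "finite (UNIV :: bit set)" by (metis finite.simps)
qed

lemma vec_add_self_bit [simp]: "x + x = (0 :: bit ^ 'n)"
  by (simp add: vec_eq_iff)

lemma vec_diff_eq_add_bit: "x - y = (x + y :: bit ^ 'n)"
  by (simp add: vec_eq_iff)

lemma vec_add_eq_0_bit: "x + y = (0 :: bit ^ 'n) \<longleftrightarrow> x = y"
  by (metis vec_diff_eq_add_bit right_minus_eq)

lemma bit_scale_cases: "c *s x = 0 \<or> c *s x = x" for x :: "bit ^ 'n"
  by (cases c) (simp_all add: vec_eq_iff)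

lemma vec_subspace_bit:
  fixes S :: "(bit ^ 'n) set"
  shows "vec.subspace S \<longleftrightarrow> 0 \<in> S \<and> (\<forall>x\<in>S. \<forall>y\<in>S. x + y \<in> S)"
  unfolding vec.subspace_def by (metis bit_scale_cases)

lemma vec_span_insert_bit:
  fixes S :: "(bit ^ 'n) set"
  shows "x \<in> vec.span (insert a S) \<longleftrightarrow> x \<in> vec.span S \<or> x + a \<in> vec.span S"
proof -
  have "(\<exists>c. x - c *s a \<in> vec.span S) \<longleftrightarrow> x \<in> vec.span S \<or> x + a \<in> vec.span S"
    by (metis bit_scale_cases diff_zero vec.scale_one vec.scale_zero_left vec_diff_eq_add_bit)
  then show ?thesis by (simp add: vec.span_breakdown_eq)
qed

text \<open>A hyperplane has index two: adjoining \<open>x\<close> fills the whole space, so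
  \<open>y\<close> or \<open>y + x\<close> lies in \<open>H\<close>, and \<open>y\<close> does
  not.\<close>

lemma hyperplane_add_closed_bit:
  fixes H :: "(bit ^ 'n::finite) set"
  assumes "H \<in> pg_hyperplanes UNIV" "x \<notin> H" "y \<notin> H"
  shows "x + y \<in> H"
proof -
  have H: "vec.subspace H" and dim: "vec.dim (UNIV :: (bit ^ 'n) set) = vec.dim H + 1"
    using assms by (auto simp: pg_hyperplanes_def pg_dim_def)
  have span_H: "vec.span H = H" using H by simp
  have "x \<notin> vec.span H" using assms by (simp only: span_H not_False_eq_True)
  then have "vec.dim (vec.span (insert x H)) = vec.dim (UNIV :: (bit ^ 'n) set)"
    unfolding dim by (simp add: vec.dim_insert)
  then have "vec.span (insert x H) = UNIV"
    by (intro vec.subspace_dim_equal) simp_all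
  then show ?thesis
    using vec_span_insert_bit[of y x H] assms span_H by (auto simp: add.commute)
qed

text \<open>Each summand outside \<open>H\<close> flips membership of the partial sum in
  \<open>H\<close>, and the empty sum lies in \<open>H\<close>.\<close>

lemma sum_mem_hyperplane_iff_even:
  fixes H T :: "(bit ^ 'n::finite) set"
  assumes H: "H \<in> pg_hyperplanes UNIV" and "finite T" "T \<inter> H = {}"
  shows "\<Sum>T \<in> H \<longleftrightarrow> even (card T)"
  using assms(2,3)
proof (induction T rule: finite_induct)
  case empty
  then show ?case using H by (auto simp: pg_hyperplanes_def vec_subspace_bit)
next
  case (insert x T)
  have sub: "vec.subspace H" using H by (auto simp: pg_hyperplanes_def)
  have x: "x \<notin> H" using insert by auto
  have "x + \<Sum>T \<in> H \<longleftrightarrow> \<Sum>T \<notin> H"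
  proof
    assume "x + \<Sum>T \<in> H"
    then show "\<Sum>T \<notin> H" using x vec.subspace_diff[OF sub] by (metis add_diff_cancel_right')
  qed (use hyperplane_add_closed_bit[OF H] x in blast)
  then show ?case using insert by auto
qed

section \<open>Blocking sets and zero sums\<close>

text \<open>Vectors common to both sets occur twice and cancel.\<close>

lemma sum_symmetric_difference_bit:
  fixes S T :: "(bit ^ 'n) set"
  assumes "finite S" "finite T"
  shows "\<Sum>S + \<Sum>T = \<Sum>((S - T) \<union> (T - S))"
proof -
  have "\<Sum>S = \<Sum>(S - T) + \<Sum>(S \<inter> T)" "\<Sum>T = \<Sum>(T - S) + \<Sum>(S \<inter> T)"
    using sum.Int_Diff[OF assms(1), of "\<lambda>x. x" T] sum.Int_Diff[OF assms(2), of "\<lambda>x. x" S]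
    by (simp_all add: Int_commute add.commute)
  moreover have "\<Sum>((S - T) \<union> (T - S)) = \<Sum>(S - T) + \<Sum>(T - S)"
    using assms by (intro sum.union_disjoint) auto
  ultimately have "\<Sum>S + \<Sum>T = \<Sum>((S - T) \<union> (T - S)) + (\<Sum>(S \<inter> T) + \<Sum>(S \<inter> T))"
    by (simp only: ac_simps)
  then show ?thesis by simp
qed

lemma even_card_symmetric_difference:
  assumes "finite S" "finite T"
  shows "even (card ((S - T) \<union> (T - S))) \<longleftrightarrow> even (card S + card T)"
proof -
  have "card S = card (S - T) + card (S \<inter> T)" "card T = card (T - S) + card (S \<inter> T)"
    using assms by (simp_all add: card_Diff_subset_Int card_mono Int_commute)
  moreover have "card ((S - T) \<union> (T - S)) = card (S - T) + card (T - S)"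
    using assms by (intro card_Un_disjoint) auto
  ultimately show ?thesis by presburger
qed

text \<open>An odd sum of vectors outside \<open>H\<close> is outside \<open>H\<close>, so it is not
  zero. Conversely, a hyperplane that contains all even sums and misses one vector of
  \<open>V\<close> misses all of \<open>V\<close>, since two vectors of \<open>V\<close> differ by
  an even sum.\<close>

lemma exists_hyperplane_missing_iff:
  fixes V :: "(bit ^ 'n::finite) set"
  shows "(\<exists>H \<in> pg_hyperplanes UNIV. V \<inter> H = {}) \<longleftrightarrow>
    \<not> (\<exists>T \<subseteq> V. odd (card T) \<and> \<Sum>T = 0)"
proof
  assume "\<exists>H \<in> pg_hyperplanes UNIV. V \<inter> H = {}"
  then obtain H where H: "H \<in> pg_hyperplanes UNIV" "V \<inter> H = {}" by blast
  have "0 \<in> H" using H by (auto simp: pg_hyperplanes_def vec_subspace_bit)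
  then show "\<not> (\<exists>T \<subseteq> V. odd (card T) \<and> \<Sum>T = 0)"
    using sum_mem_hyperplane_iff_even[OF H(1)] H(2)
    by (metis finite inf.absorb_iff1 inf_assoc inf_bot_right)
next
  assume no: "\<not> (\<exists>T \<subseteq> V. odd (card T) \<and> \<Sum>T = 0)"
  define E where "E = {s. \<exists>T\<subseteq>V. even (card T) \<and> s = \<Sum>T}"
  have E_add: "\<Sum>S + \<Sum>T \<in> E" if "S \<subseteq> V" "T \<subseteq> V" "even (card S + card T)" for S T
    unfolding E_def
    using that sum_symmetric_difference_bit[of S T] even_card_symmetric_difference[of S T]
    by (intro CollectI exI[of _ "(S - T) \<union> (T - S)"]) auto
  have E: "vec.subspace E"
    unfolding vec_subspace_bit
  proof (intro conjI ballI)
    show "0 \<in> E" using E_add[of "{}" "{}"] by simp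
    show "x + y \<in> E" if "x \<in> E" "y \<in> E" for x y
      using that E_add unfolding E_def by (smt (verit) mem_Collect_eq even_add)
  qed
  have V: "v \<notin> E" if "v \<in> V" for v
  proof
    assume "v \<in> E"
    then obtain T where T: "T \<subseteq> V" "even (card T)" "v = \<Sum>T" unfolding E_def by blast
    \<comment> \<open>Toggling \<open>v\<close> in \<open>T\<close> turns an even representation of
      \<open>v\<close> into an odd zero sum.\<close>
    let ?S = "(T - {v}) \<union> ({v} - T)"
    have "\<Sum>?S = 0"
      using sum_symmetric_difference_bit[of T "{v}"] T(3) by simp
    moreover have "odd (card ?S)"
      using even_card_symmetric_difference[of T "{v}"] T(2) by simp
    moreover have "?S \<subseteq> V" using T(1) that by blast
    ultimately show False using no by blast
  qed
  \<comment> \<open>For empty \<open>V\<close> any nonzero vector will do; \<open>1\<close> is the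
    all-ones vector.\<close>
  obtain v where v: "v \<notin> E" "V \<noteq> {} \<longrightarrow> v \<in> V"
  proof (cases "V = {}")
    case True
    then have "E = {0}" by (auto simp: E_def)
    moreover have "(1 :: bit ^ 'n) \<noteq> 0" by (simp add: vec_eq_iff)
    ultimately show ?thesis using that[of 1] True by simp
  qed (use V that in blast)
  obtain H where H: "H \<in> pg_hyperplanes UNIV" "E \<subseteq> H" "v \<notin> H"
    using exists_hyperplane_avoiding[of E UNIV v] E v by auto
  have "u \<notin> H" if u: "u \<in> V" for u
  proof
    assume "u \<in> H"
    \<comment> \<open>\<open>V\<close> contains \<open>u\<close>, so it is nonempty and
      \<open>v\<close> belongs to it; hence \<open>u + v\<close> is an even sum, also when
      \<open>u = v\<close>.\<close>
    have "u + v \<in> H" using E_add[of "{u}" "{v}"] u v H(2) by auto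
    then have "u + (u + v) \<in> H"
      using \<open>u \<in> H\<close> H(1) by (simp only: pg_hyperplanes_def vec_subspace_bit mem_Collect_eq)
    then show False using H(3) by (simp flip: add.assoc)
  qed
  then show "\<exists>H \<in> pg_hyperplanes UNIV. V \<inter> H = {}" using H(1) by blast
qed

section \<open>Points as nonzero vectors\<close>

lemma vec_subspace_pair_bit: "vec.subspace {0, v :: bit ^ 'n}"
  by (auto simp: vec_subspace_bit)

text \<open>A one-dimensional space over two scalars has a single nonzero vector, so sets of points
  can be traded for sets of nonzero vectors.\<close>

lemma pg_points_bit:
  fixes W :: "(bit ^ 'n::finite) set"
  assumes W: "vec.subspace W"
  shows "pg_points W = (\<lambda>v. {0, v}) ` (W - {0})"
proof (intro subset_antisym subsetI)
  fix P assume "P \<in> pg_points W"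
  then have P: "vec.subspace P" "P \<subseteq> W" "vec.dim P = 1" by (auto simp: pg_points_def)
  then obtain b where b: "b \<subseteq> P" "vec.independent b" "P \<subseteq> vec.span b" "card b = 1"
    by (metis vec.basis_exists)
  then obtain v where v: "b = {v}" using card_1_singletonE by blast
  have "P = vec.span {v}"
    using b P(1) v vec.span_minimal by (metis subset_antisym)
  also have "\<dots> = {0, v}"
    using vec_span_insert_bit[of _ v "{}"] by (auto simp: vec_add_eq_0_bit)
  finally have "P = {0, v}" .
  moreover have "v \<in> W" "v \<noteq> 0" using v b P(2) vec.dependent_zero by auto
  ultimately show "P \<in> (\<lambda>v. {0, v}) ` (W - {0})" by blast
next
  fix P assume "P \<in> (\<lambda>v. {0, v}) ` (W - {0})"
  then obtain v where v: "v \<in> W" "v \<noteq> 0" "P = {0, v}" by blast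
  have "vec.dim {0, v} = 1"
  proof (rule vec.dim_unique)
    show "{v} \<subseteq> {0, v}" "{0, v} \<subseteq> vec.span {v}" "card {v} = 1"
      by (auto simp: vec.span_base vec.span_zero)
    show "vec.independent {v}" using v by simp
  qed
  then show "P \<in> pg_points W"
    using v W vec_subspace_pair_bit by (auto simp: pg_points_def vec_subspace_bit)
qed

lemma inj_zero_pair: "inj_on (\<lambda>v. {0, v}) (V :: 'a::zero set)"
  by (auto simp: inj_on_def doubleton_eq_iff)

text \<open>Blocking means that no hyperplane misses \<open>V\<close>. The vector \<open>0\<close>
  has to be excluded: \<open>{0, 0}\<close> is not a point, yet \<open>{0}\<close> would be an odd
  zero sum.\<close>

lemma blocking_set_iff_zero_sum:
  fixes V :: "(bit ^ 'n::finite) set"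
  assumes "0 \<notin> V"
  shows "blocking_set ((\<lambda>v. {0, v}) ` V) \<longleftrightarrow> (\<exists>T \<subseteq> V. odd (card T) \<and> \<Sum>T = 0)"
proof -
  have "(\<lambda>v. {0, v}) ` V \<inter> pg_points H = {} \<longleftrightarrow> V \<inter> H = {}" if "H \<in> pg_hyperplanes UNIV" for H
  proof -
    have "vec.subspace H" using that by (simp add: pg_hyperplanes_def)
    then have "(\<lambda>v. {0, v}) ` V \<inter> pg_points H = (\<lambda>v. {0, v}) ` (V \<inter> (H - {0}))"
      by (simp add: pg_points_bit inj_on_image_Int[OF inj_zero_pair[of UNIV]])
    then show ?thesis using assms by auto
  qed
  moreover have "(\<lambda>v. {0, v}) ` V \<subseteq> pg_points UNIV"
    using assms by (auto simp: pg_points_bit)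
  ultimately show ?thesis
    using exists_hyperplane_missing_iff[of V] by (simp add: blocking_set_def) blast
qed

section \<open>Circuits\<close>

text \<open>For vectors over the field with two elements these are the circuits of the linear
  matroid, the minimal dependent sets, as every linear relation is a zero sum over its
  support.\<close>

definition zero_sum_circuit :: "'a::comm_monoid_add set \<Rightarrow> bool" where
  "zero_sum_circuit V \<longleftrightarrow> V \<noteq> {} \<and> \<Sum>V = 0 \<and> (\<forall>T. T \<subset> V \<and> T \<noteq> {} \<longrightarrow> \<Sum>T \<noteq> 0)"

text \<open>Minimality forces the odd zero sum to use all of \<open>V\<close>. A proper nonempty
  zero sum \<open>T\<close> then has a complement with zero sum as well, and one of the two has odd
  size, against minimality.\<close>

lemma minimal_blocking_set_iff_circuit:
  fixes V :: "(bit ^ 'n::finite) set"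
  assumes V0: "0 \<notin> V"
  shows "minimal_blocking_set ((\<lambda>v. {0, v}) ` V) \<longleftrightarrow> odd (card V) \<and> zero_sum_circuit V"
proof -
  let ?Z = "\<lambda>V. \<exists>T \<subseteq> V. odd (card T) \<and> \<Sum>T = (0 :: bit ^ 'n)"
  \<comment> \<open>Since \<open>v\<close> is determined by \<open>{0, v}\<close>, proper subsets of
    the point set correspond to proper subsets of \<open>V\<close>.\<close>
  have "(\<forall>B'. B' \<subset> (\<lambda>v. {0, v}) ` V \<longrightarrow> \<not> blocking_set B') \<longleftrightarrow>
      (\<forall>V'. V' \<subset> V \<longrightarrow> \<not> blocking_set ((\<lambda>v. {0, v}) ` V'))"
  proof (intro iffI allI impI)
    fix V' assume *: "\<forall>B'. B' \<subset> (\<lambda>v. {0, v}) ` V \<longrightarrow> \<not> blocking_set B'" and "V' \<subset> V"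
    then show "\<not> blocking_set ((\<lambda>v. {0, v}) ` V')"
      by (intro *[rule_format] image_strict_mono inj_zero_pair)
  next
    fix B' assume *: "\<forall>V'. V' \<subset> V \<longrightarrow> \<not> blocking_set ((\<lambda>v. {0, v}) ` V')"
      and B': "B' \<subset> (\<lambda>v. {0, v}) ` V"
    then obtain V' where "V' \<subseteq> V" "B' = (\<lambda>v. {0, v}) ` V'"
      by (elim psubset_imp_subset[elim_format] subset_imageE)
    moreover from this B' have "V' \<noteq> V" by force
    ultimately show "\<not> blocking_set B'" using *[rule_format, of V'] by force
  qed
  also have "\<dots> \<longleftrightarrow> (\<forall>V'. V' \<subset> V \<longrightarrow> \<not> ?Z V')"
  proof -
    have "blocking_set ((\<lambda>v. {0, v}) ` V') \<longleftrightarrow> ?Z V'" if "V' \<subset> V" for V'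
      using V0 that by (intro blocking_set_iff_zero_sum) auto
    then show ?thesis by simp
  qed
  finally have "minimal_blocking_set ((\<lambda>v. {0, v}) ` V) \<longleftrightarrow>
      ?Z V \<and> (\<forall>V'. V' \<subset> V \<longrightarrow> \<not> ?Z V')"
    unfolding minimal_blocking_set_def using blocking_set_iff_zero_sum[OF V0] by simp
  also have "\<dots> \<longleftrightarrow> odd (card V) \<and> zero_sum_circuit V"
  proof
    assume *: "?Z V \<and> (\<forall>V'. V' \<subset> V \<longrightarrow> \<not> ?Z V')"
    then have V: "odd (card V)" "\<Sum>V = 0" by (metis order_refl psubsetI)+
    have "\<Sum>T \<noteq> 0" if T: "T \<subset> V" "T \<noteq> {}" for T
    proof
      assume sum_T: "\<Sum>T = 0"
      have "\<Sum>V = \<Sum>(V - T) + \<Sum>T"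
        using T by (intro sum.subset_diff) auto
      then have "\<Sum>(V - T) = 0" using V sum_T by simp
      moreover have "card V = card (V - T) + card T"
        using T by (simp add: card_Diff_subset psubset_imp_subset card_mono)
      then have "odd (card T) \<or> odd (card (V - T))" using V(1) by auto
      moreover have "V - T \<subset> V" using T by blast
      ultimately show False using * T(1) sum_T by blast
    qed
    then show "odd (card V) \<and> zero_sum_circuit V"
      using V by (auto simp: zero_sum_circuit_def)
  next
    assume *: "odd (card V) \<and> zero_sum_circuit V"
    have "\<not> ?Z V'" if "V' \<subset> V" for V'
    proof
      assume "?Z V'"
      then obtain T where "T \<subseteq> V'" "odd (card T)" "\<Sum>T = 0" by blast
      \<comment> \<open>Odd size rules out the empty zero sum.\<close>
      moreover from this have "T \<noteq> {}" by auto
      ultimately show False using * that unfolding zero_sum_circuit_def by blast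
    qed
    then show "?Z V \<and> (\<forall>V'. V' \<subset> V \<longrightarrow> \<not> ?Z V')"
      using * unfolding zero_sum_circuit_def by blast
  qed
  finally show ?thesis .
qed

section \<open>Circuits, linear dependence and general position\<close>

text \<open>Nonzero coefficients equal 1, so a relation is the sum over its support.\<close>

lemma vec_dependent_iff_zero_sum:
  fixes V :: "(bit ^ 'n::finite) set"
  shows "vec.dependent V \<longleftrightarrow> (\<exists>T \<subseteq> V. T \<noteq> {} \<and> \<Sum>T = 0)"
proof
  assume "vec.dependent V"
  then obtain u where u: "\<exists>v\<in>V. u v \<noteq> 0" "(\<Sum>v\<in>V. u v *s v) = 0"
    by (auto simp: vec.dependent_finite)
  have "(\<Sum>v\<in>V. u v *s v) = (\<Sum>v\<in>{v\<in>V. u v \<noteq> 0}. u v *s v)"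
    by (rule sum.mono_neutral_right) auto
  also have "\<dots> = \<Sum>{v\<in>V. u v \<noteq> 0}"
    by (rule sum.cong) auto
  finally show "\<exists>T \<subseteq> V. T \<noteq> {} \<and> \<Sum>T = 0"
    using u by (intro exI[of _ "{v\<in>V. u v \<noteq> 0}"]) auto
next
  assume "\<exists>T \<subseteq> V. T \<noteq> {} \<and> \<Sum>T = 0"
  then obtain T where T: "T \<subseteq> V" "T \<noteq> {}" "\<Sum>T = 0" by blast
  have "vec.dependent T"
    using T by (auto simp: vec.dependent_finite intro!: exI[of _ "\<lambda>_. 1"])
  then show "vec.dependent V" using T(1) vec.dependent_mono by blast
qed

text \<open>A relation avoiding \<open>v\<close> would be a smaller zero sum, and the full relation
  writes \<open>v\<close> as the sum of the others: deleting any vector leaves a basis of the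
  span.\<close>

lemma circuit_remove1:
  fixes V :: "(bit ^ 'n::finite) set"
  assumes "zero_sum_circuit V" "v \<in> V"
  shows "vec.independent (V - {v})" "vec.span (V - {v}) = vec.span V"
proof -
  show "vec.independent (V - {v})"
    using assms unfolding zero_sum_circuit_def vec_dependent_iff_zero_sum by blast
  have "v + \<Sum>(V - {v}) = 0"
    using assms by (metis finite sum.remove zero_sum_circuit_def)
  then have "v = \<Sum>(V - {v})" by (simp add: vec_add_eq_0_bit)
  then have "v \<in> vec.span (V - {v})" by (metis vec.span_base vec.span_sum)
  then show "vec.span (V - {v}) = vec.span V"
    using assms(2) by (metis insert_Diff vec.span_redundant)
qed

text \<open>In a circuit, any \<open>d + 1\<close> vectors form a basis of the span and so fit in no
  hyperplane. Conversely, \<open>d + 2\<close> vectors of rank \<open>d + 1\<close> have a zero sum;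
  if it omitted some \<open>v\<close>, the remaining \<open>d + 1\<close> vectors would be dependent
  and lie in a hyperplane of the span.\<close>

lemma zero_sum_circuit_iff_general_position:
  fixes V :: "(bit ^ 'n::finite) set"
  assumes card_V: "card V = d + 2"
  shows "zero_sum_circuit V \<longleftrightarrow> vec.dim V = d + 1 \<and>
    (\<forall>S. S \<subseteq> V \<and> card S = d + 1 \<longrightarrow> \<not> (\<exists>H \<in> pg_hyperplanes (vec.span V). S \<subseteq> H))"
    (is "_ \<longleftrightarrow> _ \<and> ?G")
proof
  assume circuit: "zero_sum_circuit V"
  have dim: "vec.dim V = d + 1"
  proof -
    obtain v where v: "v \<in> V" using circuit unfolding zero_sum_circuit_def by blast
    have "vec.dim V = card (V - {v})"
      using circuit_remove1[OF circuit v] by (metis vec.dim_span vec.dim_eq_card_independent)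
    then show ?thesis using v card_V by simp
  qed
  moreover have ?G
  proof (intro allI impI notI)
    fix S assume S: "S \<subseteq> V \<and> card S = d + 1" and
      "\<exists>H \<in> pg_hyperplanes (vec.span V). S \<subseteq> H"
    then obtain H where H: "vec.subspace H" "vec.dim V = vec.dim H + 1" "S \<subseteq> H"
      by (auto simp: pg_hyperplanes_def pg_dim_def)
    have "card (V - S) = 1" using S card_V by (simp add: card_Diff_subset)
    then obtain v where v: "V - S = {v}" by (rule card_1_singletonE)
    then have "S = V - {v}" "v \<in> V" using S by blast+
    then have "vec.dim S = vec.dim V"
      using circuit_remove1(2)[OF circuit] by (metis vec.dim_span)
    then show False using H vec.dim_subset[of S H] by simp
  qed
  ultimately show "vec.dim V = d + 1 \<and> ?G" by blast
next
  assume *: "vec.dim V = d + 1 \<and> ?G"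
  have "vec.dependent V"
    using * card_V vec.dim_eq_card_independent by force
  then obtain T where T: "T \<subseteq> V" "T \<noteq> {}" "\<Sum>T = 0"
    by (auto simp: vec_dependent_iff_zero_sum)
  have whole: "T = V" if T: "T \<subseteq> V" "T \<noteq> {}" "\<Sum>T = 0" for T
  proof (rule ccontr)
    assume "T \<noteq> V"
    then obtain v where v: "v \<in> V" "v \<notin> T" using T by blast
    let ?U = "V - {v}"
    have card_U: "card ?U = d + 1" using v card_V by simp
    have "T \<subseteq> ?U" using T v by blast
    then have "vec.dependent ?U"
      using T unfolding vec_dependent_iff_zero_sum by blast
    \<comment> \<open>A spanning set whose size is at most the dimension would be
      independent.\<close>
    then have "vec.dim ?U < d + 1"
      using card_U by (metis finite order_le_less vec.card_le_dim_spanning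
          vec.dim_le_card' vec.span_superset)
    then have "vec.span ?U \<noteq> vec.span V" using * by (metis nat_neq_iff vec.dim_span)
    moreover have "vec.span ?U \<subseteq> vec.span V" by (simp add: vec.span_mono)
    ultimately obtain w where "w \<in> vec.span V" "w \<notin> vec.span ?U" by blast
    then obtain H where "H \<in> pg_hyperplanes (vec.span V)" "vec.span ?U \<subseteq> H"
      using \<open>vec.span ?U \<subseteq> vec.span V\<close>
      by (metis exists_hyperplane_avoiding vec.subspace_span)
    moreover have "?U \<subseteq> vec.span ?U" by (rule vec.span_superset)
    ultimately show False using * card_U by blast
  qed
  then show "zero_sum_circuit V"
    using T unfolding zero_sum_circuit_def by blast
qed

text \<open>The set \<open>B\<close> is replaced by the set \<open>V\<close> of nonzero vectors of
  its points, which has the same span and size; the two characterisations of odd circuits are then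
  chained.\<close>

theorem theorem1p2:
  fixes n :: nat and B :: "(bit ^ 'n::finite) set set"
  assumes "n \<ge> 1"
    and "CARD('n) = n + 1"
    and "B \<subseteq> pg_points UNIV"
  shows "minimal_blocking_set B \<longleftrightarrow>
    (\<exists>d::nat. pg_dim (pg_span B) = int d \<and> odd d
      \<and> B \<subseteq> pg_points (pg_span B) \<and> card B = d + 2
      \<and> (\<forall>S. S \<subseteq> B \<and> card S = d + 1 \<longrightarrow>
            \<not> (\<exists>H \<in> pg_hyperplanes (pg_span B). S \<subseteq> pg_points H)))"
proof -
  let ?p = "\<lambda>v :: bit ^ 'n. {0, v}"
  obtain V where "V \<subseteq> UNIV - {0}" and B: "B = ?p ` V"
    using assms(3) by (auto simp: pg_points_bit elim: subset_imageE)
  then have V0: "0 \<notin> V" by blast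
  have card_image_p: "card (?p ` S) = card S" for S
    by (rule card_image) (rule inj_zero_pair)
  have "vec.span (\<Union>B) = vec.span V"
  proof (rule vec.span_eq[THEN iffD2], intro conjI)
    show "\<Union>B \<subseteq> vec.span V" by (auto simp: B vec.span_base vec.span_zero)
    show "V \<subseteq> vec.span (\<Union>B)" by (auto simp: B intro!: vec.span_base)
  qed
  then have span_B: "pg_span B = vec.span V" by (simp add: pg_span_def)
  have B_points: "B \<subseteq> pg_points (pg_span B)"
    unfolding span_B using V0 by (auto simp: B pg_points_bit vec.span_base)
  have points_iff: "?p ` S \<subseteq> pg_points H \<longleftrightarrow> S \<subseteq> H"
    if "S \<subseteq> V" "H \<in> pg_hyperplanes (vec.span V)" for S H
  proof -
    have "vec.subspace H" using that by (simp add: pg_hyperplanes_def)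
    then have "?p ` S \<subseteq> pg_points H \<longleftrightarrow> S \<subseteq> H - {0}"
      by (simp add: pg_points_bit inj_image_subset_iff[OF inj_zero_pair])
    then show ?thesis using that(1) V0 by blast
  qed
  \<comment> \<open>Subsets of \<open>B\<close> are the images of subsets of \<open>V\<close>, with
    the same size and in the same hyperplanes.\<close>
  have general_position_iff:
    "(\<forall>S. S \<subseteq> B \<and> card S = m \<longrightarrow>
        \<not> (\<exists>H \<in> pg_hyperplanes (pg_span B). S \<subseteq> pg_points H)) \<longleftrightarrow>
     (\<forall>S. S \<subseteq> V \<and> card S = m \<longrightarrow> \<not> (\<exists>H \<in> pg_hyperplanes (vec.span V). S \<subseteq> H))" for m
    unfolding span_B
    unfolding B imp_conjL all_subset_image
    using points_iff card_image_p by auto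
  have "minimal_blocking_set B \<longleftrightarrow> odd (card V) \<and> zero_sum_circuit V"
    unfolding B by (rule minimal_blocking_set_iff_circuit[OF V0])
  also have "\<dots> \<longleftrightarrow> (\<exists>d. odd d \<and> card V = d + 2 \<and> zero_sum_circuit V)"
  proof (intro iffI conjI)
    assume *: "odd (card V) \<and> zero_sum_circuit V"
    \<comment> \<open>The witness is \<open>d = card V - 2\<close>; truncated subtraction is
      harmless because an odd size other than 1 is at least 3.\<close>
    have "card V \<noteq> 1"
    proof
      assume "card V = 1"
      then obtain v where "V = {v}" by (rule card_1_singletonE)
      then show False using * V0 by (simp add: zero_sum_circuit_def)
    qed
    with * have "card V = (card V - 2) + 2" "odd (card V - 2)"
      by (auto elim!: oddE)
    with * show "\<exists>d. odd d \<and> card V = d + 2 \<and> zero_sum_circuit V" by blast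
  qed auto
  also have "\<dots> \<longleftrightarrow> (\<exists>d::nat. pg_dim (pg_span B) = int d \<and> odd d
      \<and> B \<subseteq> pg_points (pg_span B) \<and> card B = d + 2
      \<and> (\<forall>S. S \<subseteq> B \<and> card S = d + 1 \<longrightarrow>
            \<not> (\<exists>H \<in> pg_hyperplanes (pg_span B). S \<subseteq> pg_points H)))"
  proof (intro ex_cong1)
    fix d
    \<comment> \<open>Projective dimension is one less than linear rank.\<close>
    have "pg_dim (pg_span B) = int d \<longleftrightarrow> vec.dim V = d + 1"
      by (auto simp: span_B pg_dim_def)
    moreover have "card B = card V" by (simp add: B card_image_p)
    ultimately show "odd d \<and> card V = d + 2 \<and> zero_sum_circuit V \<longleftrightarrow>
      pg_dim (pg_span B) = int d \<and> odd d
      \<and> B \<subseteq> pg_points (pg_span B) \<and> card B = d + 2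
      \<and> (\<forall>S. S \<subseteq> B \<and> card S = d + 1 \<longrightarrow>
            \<not> (\<exists>H \<in> pg_hyperplanes (pg_span B). S \<subseteq> pg_points H))"
      using zero_sum_circuit_iff_general_position[of V d] B_points
      unfolding general_position_iff by auto
  qed
  finally show ?thesis .
qed

end
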